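(* Fix weights $\lambda^1,\dots,\lambda^M\in(0,1)$ with $\sum_{i=1}^M\lambda^i=1$, and let $\mathbf{u}_{(p-1)}$ be a feasible point of the centralized MPC problem (C). For each $j$ let $\mathbf{u}^{s|j}_{(p)}$ be the minimizer of the local problem of subsystem $j$ with assumed sequence $\mathbf{u}_{(p-1)}$, and for $i\in\mathcal{N}^j$ let $\mathbf{u}^{i|j*}_{(p)}$ be the component of $\mathbf{u}^{s|j}_{(p)}$ belonging to subsystem $i$ (problem (C), the local problems and $\mathcal{N}^j$ are defined in the context). Then the global update $$\mathbf{u}_{(p)}=\sum_{j=1}^M\lambda^j\,\mathbf{u}^{s|j}_{(p)}$$ and the local updates $$\mathbf{u}^i_{(p)}=\sum_{j\in\mathcal{N}^i}\lambda^j\,\mathbf{u}^{i|j*}_{(p)}+\Big(1-\sum_{j\in\mathcal{N}^i}\lambda^j\Big)\mathbf{u}^i_{(p-1)},\qquad i=1,\dots,M,$$ yield the same result, i.e. the $i$-th component of the globally updated sequence equals the locally updated sequence of subsystem $i$, for every $i$.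
   Context: Plant: there are $M$ subsystems with states $x^i\in\mathbb{R}^{n_i}$, inputs $u^i\in\mathbb{R}^{m_i}$ and dynamics $x^i_{t+1}=\sum_{j=1}^M(A_{ij}x^j_t+B_{ij}u^j_t)$. With $x=(x^1,\dots,x^M)$, $u=(u^1,\dots,u^M)$, $A=(A_{ij})$, $B=(B_{ij})$, this reads $x_{t+1}=Ax_t+Bu_t$; the pair $(A,B)$ is stabilizable. Neighborhoods: $\mathcal{N}^i\subseteq\{1,\dots,M\}$ denotes the set consisting of $i$ and all indices of subsystems having a direct dynamical coupling or a direct constraint coupling with subsystem $i$; thus $i\in\mathcal{N}^i$, and $j\in\mathcal{N}^i\Leftrightarrow i\in\mathcal{N}^j$. For a vector $w=(w^1,\dots,w^M)$, $w^{+i}$ denotes the collection of components $w^j$ with $j\in\mathcal{N}^i$, and $w^{\bar i}$ the collection of components with $j\notin\mathcal{N}^i$. Constraints: for each $i$ there are convex coupled constraints $x^{+i}\in\mathcal{X}^{+i}(x^{\bar i})$, $u^{+i}\in\mathcal{U}^{+i}(u^{\bar i})$, with closed convex sets parameterized by the components outside $\mathcal{N}^i$. The sets $\mathcal{X}$ and $\mathcal{U}$ are the closed convex sets of all full vectors $x$, respectively $u$, satisfying these constraints for all $i=1,\dots,M$. Cost: $N\ge1$ is the prediction horizon, $Q=\mathrm{diag}(Q_1,\dots,Q_M)$ and $R=\mathrm{diag}(R_1,\dots,R_M)$ are block diagonal with $Q_i$ (symmetric) positive semidefinite and $R_i$ (symmetric) positive definite. For an input sequence $\mathbf{u}=(u_0,\dots,u_{N-1})$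 and fixed initial state $x_0$, let $x_{k+1}=Ax_k+Bu_k$ and $V(\mathbf{u},x_0)=\sum_{k=0}^{N-1}\left(x_k^TQx_k+u_k^TRu_k\right)$. The input sequence of subsystem $i$ in $\mathbf{u}$ is $\mathbf{u}^i=(u^i_0,\dots,u^i_{N-1})$. Centralized MPC problem (C): minimize $V(\mathbf{u},x_0)$ over $\mathbf{u}$ subject to $u_k\in\mathcal{U}$ for $k=0,\dots,N-1$, $x_k\in\mathcal{X}$ for $k=1,\dots,N$, and $x_N=0$. Local problem of subsystem $i$, given an assumed feasible sequence $\hat{\mathbf{u}}$: minimize $V(\mathbf{u},x_0)$ subject to all constraints of (C) and $\mathbf{u}^{\bar i}=\hat{\mathbf{u}}^{\bar i}$; that is, only the inputs of the subsystems in $\mathcal{N}^i$ are optimized. *)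

theory Defs
  imports "HOL-Analysis.Analysis"
begin

text \<open>
  Subsystems are the elements of a finite type \<open>'i\<close>.  Global states and inputs are vectors
  \<open>real ^ 's\<close> and \<open>real ^ 'u\<close>; an owner map assigns to each coordinate the subsystem it belongs to,
  so that the dimension of subsystem \<open>i\<close> is the number of coordinates it owns, and differs from
  subsystem to subsystem.  The subvector formed by the components of the subsystems in \<open>J\<close> is
  represented with zeros in the remaining coordinates.  In particular \<open>subvec own {i} w\<close> is the
  component of subsystem \<open>i\<close>.
\<close>

definition subvec :: "('c::finite \<Rightarrow> 'i) \<Rightarrow> 'i set \<Rightarrow> real ^ 'c \<Rightarrow> real ^ 'c" where
  "subvec own J w = (\<chi> c. if own c \<in> J then w $ c else 0)"

definition block ::
  "('r::finite \<Rightarrow> 'i) \<Rightarrow> ('c::finite \<Rightarrow> 'i) \<Rightarrow> 'i \<Rightarrow> 'i \<Rightarrow> real ^ 'c ^ 'r \<Rightarrow> real ^ 'c ^ 'r" where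
  "block rown cown i j A = (\<chi> a b. if rown a = i \<and> cown b = j then A $ a $ b else 0)"

definition block_diagonal :: "('c::finite \<Rightarrow> 'i::finite) \<Rightarrow> real ^ 'c ^ 'c \<Rightarrow> bool" where
  "block_diagonal own W \<longleftrightarrow> W = (\<Sum>i\<in>UNIV. block own own i i W)"

definition sym_psd_block :: "('c::finite \<Rightarrow> 'i) \<Rightarrow> 'i \<Rightarrow> real ^ 'c ^ 'c \<Rightarrow> bool" where
  "sym_psd_block own i W \<longleftrightarrow>
     transpose (block own own i i W) = block own own i i W \<and>
     (\<forall>v. subvec own {i} v = v \<longrightarrow> 0 \<le> v \<bullet> (block own own i i W *v v))"

definition sym_pd_block :: "('c::finite \<Rightarrow> 'i) \<Rightarrow> 'i \<Rightarrow> real ^ 'c ^ 'c \<Rightarrow> bool" where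
  "sym_pd_block own i W \<longleftrightarrow>
     transpose (block own own i i W) = block own own i i W \<and>
     (\<forall>v. subvec own {i} v = v \<and> v \<noteq> 0 \<longrightarrow> 0 < v \<bullet> (block own own i i W *v v))"

definition schur_stable :: "real ^ 'c ^ 'c::finite \<Rightarrow> bool" where
  "schur_stable W \<longleftrightarrow>
     (\<forall>(z::complex) v. v \<noteq> 0 \<and> (\<chi> a b. complex_of_real (W $ a $ b)) *v v = z *s v \<longrightarrow> cmod z < 1)"

definition stabilizable :: "real ^ 's ^ 's::finite \<Rightarrow> real ^ 'u::finite ^ 's \<Rightarrow> bool" where
  "stabilizable A B \<longleftrightarrow> (\<exists>K :: real ^ 's ^ 'u. schur_stable (A + B ** K))"

text \<open>
  \<open>ccoup i j\<close> says that \<open>i\<close> and \<open>j\<close> have a direct constraint coupling; it is a primitive datum, so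
  that the neighborhoods determined by it can serve to index the constraint sets
  \<open>Xcon i\<close> and \<open>Ucon i\<close>, which take the components outside the neighborhood of \<open>i\<close> as parameter.
\<close>

record ('i, 's, 'u) mpc =
  sown :: "'s::finite \<Rightarrow> 'i"
  uown :: "'u::finite \<Rightarrow> 'i"
  Amat :: "real ^ 's ^ 's"
  Bmat :: "real ^ 'u ^ 's"
  ccoup :: "'i \<Rightarrow> 'i \<Rightarrow> bool"
  Xcon :: "'i \<Rightarrow> real ^ 's \<Rightarrow> (real ^ 's) set"
  Ucon :: "'i \<Rightarrow> real ^ 'u \<Rightarrow> (real ^ 'u) set"
  Qmat :: "real ^ 's ^ 's"
  Rmat :: "real ^ 'u ^ 'u"
  horizon :: nat

text \<open>\<open>dcoup P i j\<close>: the dynamics of \<open>i\<close> depend directly on the state or the input of \<open>j\<close>.\<close>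

definition dcoup :: "('i, 's::finite, 'u::finite) mpc \<Rightarrow> 'i \<Rightarrow> 'i \<Rightarrow> bool" where
  "dcoup P i j \<longleftrightarrow>
     block (sown P) (sown P) i j (Amat P) \<noteq> 0 \<or> block (sown P) (uown P) i j (Bmat P) \<noteq> 0"

definition nbhd :: "('i, 's::finite, 'u::finite) mpc \<Rightarrow> 'i \<Rightarrow> 'i set" where
  "nbhd P i = {i} \<union> {j. dcoup P i j \<or> dcoup P j i \<or> ccoup P i j}"

definition Xset :: "('i, 's::finite, 'u::finite) mpc \<Rightarrow> (real ^ 's) set" where
  "Xset P = {x. \<forall>i. subvec (sown P) (nbhd P i) x \<in> Xcon P i (subvec (sown P) (- nbhd P i) x)}"

definition Uset :: "('i, 's::finite, 'u::finite) mpc \<Rightarrow> (real ^ 'u) set" where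
  "Uset P = {u. \<forall>i. subvec (uown P) (nbhd P i) u \<in> Ucon P i (subvec (uown P) (- nbhd P i) u)}"

definition mpc_setup :: "('i::finite, 's::finite, 'u::finite) mpc \<Rightarrow> bool" where
  "mpc_setup P \<longleftrightarrow>
     stabilizable (Amat P) (Bmat P) \<and>
     (\<forall>i j. ccoup P i j \<longrightarrow> ccoup P j i) \<and>
     (\<forall>i w. subvec (sown P) (- nbhd P i) w = w \<longrightarrow>
        closed (Xcon P i w) \<and> convex (Xcon P i w) \<and>
        Xcon P i w \<subseteq> {v. subvec (sown P) (nbhd P i) v = v}) \<and>
     (\<forall>i w. subvec (uown P) (- nbhd P i) w = w \<longrightarrow>
        closed (Ucon P i w) \<and> convex (Ucon P i w) \<and>
        Ucon P i w \<subseteq> {v. subvec (uown P) (nbhd P i) v = v}) \<and>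
     closed (Xset P) \<and> convex (Xset P) \<and>
     closed (Uset P) \<and> convex (Uset P) \<and>
     block_diagonal (sown P) (Qmat P) \<and> (\<forall>i. sym_psd_block (sown P) i (Qmat P)) \<and>
     block_diagonal (uown P) (Rmat P) \<and> (\<forall>i. sym_pd_block (uown P) i (Rmat P)) \<and>
     1 \<le> horizon P"

primrec traj ::
  "('i, 's::finite, 'u::finite) mpc \<Rightarrow> real ^ 's \<Rightarrow> (nat \<Rightarrow> real ^ 'u) \<Rightarrow> nat \<Rightarrow> real ^ 's" where
  "traj P x0 u 0 = x0"
| "traj P x0 u (Suc k) = Amat P *v traj P x0 u k + Bmat P *v u k"

definition cost ::
  "('i, 's::finite, 'u::finite) mpc \<Rightarrow> real ^ 's \<Rightarrow> (nat \<Rightarrow> real ^ 'u) \<Rightarrow> real" where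
  "cost P x0 u =
     (\<Sum>k<horizon P. traj P x0 u k \<bullet> (Qmat P *v traj P x0 u k) + u k \<bullet> (Rmat P *v u k))"

text \<open>
  An input sequence of length \<open>N\<close> is a function on \<open>nat\<close> that vanishes from \<open>N\<close> on, so that equality
  of such functions is equality of the sequences and minimizers can be unique.
\<close>

definition input_seqs :: "('i, 's::finite, 'u::finite) mpc \<Rightarrow> (nat \<Rightarrow> real ^ 'u) set" where
  "input_seqs P = {u. \<forall>k\<ge>horizon P. u k = 0}"

definition feasible ::
  "('i, 's::finite, 'u::finite) mpc \<Rightarrow> real ^ 's \<Rightarrow> (nat \<Rightarrow> real ^ 'u) set" where
  "feasible P x0 = {u \<in> input_seqs P.
     (\<forall>k<horizon P. u k \<in> Uset P) \<and>
     (\<forall>k\<in>{1..horizon P}. traj P x0 u k \<in> Xset P) \<and>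
     traj P x0 u (horizon P) = 0}"

definition input_part ::
  "('i, 's::finite, 'u::finite) mpc \<Rightarrow> 'i set \<Rightarrow> (nat \<Rightarrow> real ^ 'u) \<Rightarrow> nat \<Rightarrow> real ^ 'u" where
  "input_part P J u = (\<lambda>k. subvec (uown P) J (u k))"

definition local_feasible ::
  "('i, 's::finite, 'u::finite) mpc \<Rightarrow> real ^ 's \<Rightarrow> (nat \<Rightarrow> real ^ 'u) \<Rightarrow> 'i \<Rightarrow>
     (nat \<Rightarrow> real ^ 'u) set" where
  "local_feasible P x0 uhat i =
     {u \<in> feasible P x0. input_part P (- nbhd P i) u = input_part P (- nbhd P i) uhat}"

text \<open>
  The minimizer exists and is unique whenever \<open>mpc_setup P\<close> holds and \<open>uhat\<close> is feasible: the
  local feasible set is then nonempty, closed and convex, and the cost is coercive and strictly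
  convex because the blocks of \<open>Rmat P\<close> are positive definite.
\<close>

definition local_minimizer ::
  "('i, 's::finite, 'u::finite) mpc \<Rightarrow> real ^ 's \<Rightarrow> (nat \<Rightarrow> real ^ 'u) \<Rightarrow> 'i \<Rightarrow> nat \<Rightarrow> real ^ 'u" where
  "local_minimizer P x0 uhat i =
     (THE u. is_arg_min (cost P x0) (\<lambda>v. v \<in> local_feasible P x0 uhat i) u)"

end

theory Submission
  imports Defs
begin

text \<open>
  Once the minimizers are known to lie in the local feasible sets, the two updates agree by a
  rearrangement of a weighted sum.  Coupling is symmetric, so a subsystem \<open>j\<close> outside the
  neighborhood of \<open>i\<close> does not have \<open>i\<close> in its own neighborhood either; the local problem of \<open>j\<close>
  therefore keeps component \<open>i\<close> at its previous value.  In the global average these \<open>j\<close>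
  contribute that previous value with total weight \<open>1 - (\<Sum>j\<in>nbhd P i. lam j)\<close>, which is
  precisely the local update.

  The analytic part of the proof is that \<open>local_minimizer\<close>, a definite description, does
  denote a point of the local feasible set: a minimizer exists and is unique
  (\<open>local_minimizer_feasible\<close>).  Both halves rest on the positive definiteness of \<open>Rmat P\<close>, which
  its blocks pass on to the whole matrix.  For existence it bounds every input of a sequence by
  the cost (\<open>cost_coercive\<close>), so a sublevel set lies in a product of balls, which is compact by
  Tychonoff's theorem, and the continuous cost attains its infimum there.  For uniqueness,
  the cost at the midpoint of two distinct minimizers would lie strictly below the minimum
  (\<open>cost_midpoint\<close>), although the midpoint is feasible because the dynamics are linear and the
  constraint sets are convex.
\<close>

section \<open>Neighborhoods and subvectors\<close>

lemma nbhd_sym: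
  assumes "mpc_setup P"
  shows "j \<in> nbhd P i \<longleftrightarrow> i \<in> nbhd P j"
  using assms unfolding mpc_setup_def nbhd_def by auto

lemma linear_subvec: "linear (subvec own J)"
  by (rule linearI) (auto simp: subvec_def vec_eq_iff)

lemma subvec_mono_eq:
  assumes "subvec own J v = subvec own J w" "I \<subseteq> J"
  shows "subvec own I v = subvec own I w"
proof -
  have "v $ c = w $ c" if "own c \<in> J" for c
    using arg_cong[OF assms(1), of "\<lambda>x. x $ c"] that by (simp add: subvec_def)
  then show ?thesis
    using assms(2) by (auto simp: subvec_def vec_eq_iff)
qed

section \<open>Quadratic forms\<close>

lemma sum_matrix_vector_mult:
  fixes W :: "'i \<Rightarrow> real ^ 'c::finite ^ 'r::finite"
  shows "(\<Sum>i\<in>I. W i) *v v = (\<Sum>i\<in>I. W i *v v)"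
  by (induction I rule: infinite_finite_induct) (simp_all add: matrix_vector_mult_add_rdistrib)

lemma inner_block_subvec:
  "v \<bullet> (block own own i i W *v v)
     = subvec own {i} v \<bullet> (block own own i i W *v subvec own {i} v)"
  unfolding inner_vec_def matrix_vector_mult_def block_def subvec_def
  by (auto intro!: sum.cong)

lemma block_diagonal_inner:
  assumes "block_diagonal own W"
  shows "v \<bullet> (W *v v)
    = (\<Sum>i\<in>UNIV. subvec own {i} v \<bullet> (block own own i i W *v subvec own {i} v))"
proof -
  have "v \<bullet> (W *v v) = v \<bullet> ((\<Sum>i\<in>UNIV. block own own i i W) *v v)"
    using assms unfolding block_diagonal_def by simp
  also have "\<dots> = (\<Sum>i\<in>UNIV. v \<bullet> (block own own i i W *v v))"
    by (simp add: sum_matrix_vector_mult inner_sum_right)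
  finally show ?thesis
    by (simp only: inner_block_subvec[symmetric])
qed

lemma subvec_idem: "subvec own J (subvec own J v) = subvec own J v"
  by (simp add: subvec_def vec_eq_iff)

lemma block_diagonal_psd:
  assumes "block_diagonal own W" "\<forall>i. sym_psd_block own i W"
  shows "0 \<le> v \<bullet> (W *v v)"
  using assms(2) unfolding block_diagonal_inner[OF assms(1)] sym_psd_block_def
  by (intro sum_nonneg) (simp add: subvec_idem)

text \<open>
  A nonzero vector has a nonzero component in some block; that block contributes a positive term
  and the others contribute nonnegative ones.
\<close>

lemma block_diagonal_pd:
  assumes "block_diagonal own W" "\<forall>i. sym_pd_block own i W" "v \<noteq> 0"
  shows "0 < v \<bullet> (W *v v)"
proof -
  obtain c where "v $ c \<noteq> 0"
    using assms(3) by (auto simp: vec_eq_iff)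
  then have "subvec own {own c} v \<noteq> 0"
    by (auto simp: subvec_def vec_eq_iff)
  then have pos: "0 < subvec own {own c} v \<bullet> (block own own (own c) (own c) W *v subvec own {own c} v)"
    using assms(2) unfolding sym_pd_block_def by (simp add: subvec_idem)
  have nonneg: "0 \<le> subvec own {i} v \<bullet> (block own own i i W *v subvec own {i} v)" for i
    using assms(2) unfolding sym_pd_block_def
    by (cases "subvec own {i} v = 0") (auto simp: subvec_idem less_imp_le)
  show ?thesis
    unfolding block_diagonal_inner[OF assms(1)]
    by (rule sum_pos2[where i = "own c"]) (use pos nonneg in auto)
qed

text \<open>
  The constant is the minimum of the form on the unit sphere; homogeneity carries the bound to
  all vectors.
\<close>

lemma positive_definite_coercive:
  fixes W :: "real ^ 'c::finite ^ 'c"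
  assumes "\<And>v. v \<noteq> 0 \<Longrightarrow> 0 < v \<bullet> (W *v v)"
  obtains c where "0 < c" "\<And>v. c * (norm v)\<^sup>2 \<le> v \<bullet> (W *v v)"
proof -
  have cont: "continuous_on (sphere 0 1) (\<lambda>v. v \<bullet> (W *v v))"
    by (intro continuous_intros linear_continuous_on matrix_vector_mul_bounded_linear)
  have ne: "sphere (0 :: real ^ 'c) 1 \<noteq> {}"
    by simp
  obtain w where w: "w \<in> sphere 0 1"
    and min: "\<And>v. v \<in> sphere 0 1 \<Longrightarrow> w \<bullet> (W *v w) \<le> v \<bullet> (W *v v)"
    using continuous_attains_inf[OF compact_sphere ne cont] by blast
  show thesis
  proof
    show "0 < w \<bullet> (W *v w)"
      using w by (intro assms) auto
    show "w \<bullet> (W *v w) * (norm v)\<^sup>2 \<le> v \<bullet> (W *v v)" for v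
    proof (cases "v = 0")
      case False
      have "w \<bullet> (W *v w) \<le> (v /\<^sub>R norm v) \<bullet> (W *v (v /\<^sub>R norm v))"
        using False by (intro min) simp
      also have "\<dots> = v \<bullet> (W *v v) / (norm v)\<^sup>2"
        by (simp add: matrix_vector_mult_scaleR power2_eq_square divide_simps)
      finally show ?thesis
        using False by (simp add: field_simps)
    qed simp
  qed
qed

lemma quadratic_form_midpoint:
  fixes W :: "real ^ 'c::finite ^ 'c"
  shows "((1 / 2) *\<^sub>R (v + w)) \<bullet> (W *v ((1 / 2) *\<^sub>R (v + w)))
     = (v \<bullet> (W *v v) + w \<bullet> (W *v w)) / 2 - (v - w) \<bullet> (W *v (v - w)) / 4"
proof -
  have "(v + w) \<bullet> (W *v (v + w)) + (v - w) \<bullet> (W *v (v - w))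
      = 2 * (v \<bullet> (W *v v)) + 2 * (w \<bullet> (W *v w))"
    unfolding matrix_vector_right_distrib matrix_vector_mult_diff_distrib inner_add_left
      inner_add_right inner_diff_left inner_diff_right by linarith
  moreover have "1 / 2 * (1 / 2 * a) = (c + d) / 2 - b / 4" if "a + b = 2 * c + 2 * d"
    for a b c d :: real
    using that by (simp add: field_simps)
  ultimately show ?thesis
    by (simp only: matrix_vector_mult_scaleR inner_scaleR_left inner_scaleR_right)
qed

section \<open>The local feasible sets\<close>

lemma traj_midpoint:
  "traj P x0 (\<lambda>k. (1 / 2) *\<^sub>R (u k + v k)) k = (1 / 2) *\<^sub>R (traj P x0 u k + traj P x0 v k)"
proof (induction k)
  case 0
  show ?case
    by (simp add: scaleR_2[symmetric])
next
  case (Suc k)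
  then show ?case
    by (simp add: matrix_vector_mult_scaleR matrix_vector_right_distrib scaleR_add_right)
qed

lemma convex_midpoint:
  assumes "convex S" "v \<in> S" "w \<in> S"
  shows "(1 / 2) *\<^sub>R (v + w) \<in> S"
  using convexD[OF assms, of "1/2" "1/2"] by (simp add: scaleR_add_right)

lemma local_feasible_midpoint:
  assumes plant: "mpc_setup P"
    and u: "u \<in> local_feasible P x0 uhat i" and v: "v \<in> local_feasible P x0 uhat i"
  shows "(\<lambda>k. (1 / 2) *\<^sub>R (u k + v k)) \<in> local_feasible P x0 uhat i"
proof -
  have cvx: "convex (Xset P)" "convex (Uset P)"
    using plant unfolding mpc_setup_def by auto
  have "subvec (uown P) (- nbhd P i) ((1 / 2) *\<^sub>R (u k + v k)) = subvec (uown P) (- nbhd P i) (uhat k)" for k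
  proof -
    have "subvec (uown P) (- nbhd P i) (u k) = subvec (uown P) (- nbhd P i) (uhat k)"
      "subvec (uown P) (- nbhd P i) (v k) = subvec (uown P) (- nbhd P i) (uhat k)"
      using u v unfolding local_feasible_def input_part_def by (auto dest: fun_cong)
    then show ?thesis
      by (simp add: linear_scale[OF linear_subvec] linear_add[OF linear_subvec] scaleR_2[symmetric])
  qed
  then show ?thesis
    using u v unfolding local_feasible_def feasible_def input_seqs_def input_part_def
    by (auto simp: traj_midpoint convex_midpoint[OF cvx(1)] convex_midpoint[OF cvx(2)])
qed

lemma continuous_on_coordinate [continuous_intros]:
  "continuous_on S (\<lambda>u :: nat \<Rightarrow> 'a::topological_space. u k)"
  by (rule continuous_on_subset[OF continuous_on_product_coordinates]) simp

lemma continuous_on_matrix_vector_mult [continuous_intros]: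
  fixes W :: "real ^ 'c::finite ^ 'r::finite"
  assumes "continuous_on S f"
  shows "continuous_on S (\<lambda>x. W *v f x)"
  by (rule bounded_linear.continuous_on[OF matrix_vector_mul_bounded_linear assms])

lemma continuous_on_subvec [continuous_intros]:
  assumes "continuous_on S f"
  shows "continuous_on S (\<lambda>x. subvec own J (f x))"
  by (rule bounded_linear.continuous_on[OF linear_conv_bounded_linear[THEN iffD1, OF linear_subvec] assms])

lemma continuous_on_traj [continuous_intros]: "continuous_on S (\<lambda>u. traj P x0 u k)"
proof (induction k)
  case (Suc k)
  then show ?case
    unfolding traj.simps by (intro continuous_intros)
qed simp

lemma continuous_on_cost: "continuous_on S (cost P x0)"
  unfolding cost_def by (intro continuous_intros)

text \<open>
  The topology on sequences is the product topology, in which every constraint is a closed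
  condition because it involves the sequence only through continuous maps into
  finite-dimensional spaces.
\<close>

lemma closed_local_feasible:
  assumes "mpc_setup P"
  shows "closed (local_feasible P x0 uhat i)"
proof -
  have cl: "closed (Xset P)" "closed (Uset P)"
    using assms unfolding mpc_setup_def by auto
  have eq: "local_feasible P x0 uhat i =
      (\<Inter>k\<in>{horizon P..}. {u. u k = 0})
      \<inter> (\<Inter>k\<in>{..<horizon P}. (\<lambda>u. u k) -` Uset P)
      \<inter> (\<Inter>k\<in>{1..horizon P}. (\<lambda>u. traj P x0 u k) -` Xset P)
      \<inter> {u. traj P x0 u (horizon P) = 0}
      \<inter> (\<Inter>k. {u. subvec (uown P) (- nbhd P i) (u k) = subvec (uown P) (- nbhd P i) (uhat k)})"
    unfolding local_feasible_def feasible_def input_seqs_def input_part_def fun_eq_iff by auto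
  show ?thesis
    unfolding eq
    by (intro closed_Int closed_INT ballI closed_Collect_eq closed_vimage cl continuous_intros)
qed

section \<open>Existence and uniqueness of the local minimizer\<close>

lemma stage_cost_definite:
  assumes "mpc_setup P"
  shows "0 \<le> x \<bullet> (Qmat P *v x)" and "v \<noteq> 0 \<Longrightarrow> 0 < v \<bullet> (Rmat P *v v)"
proof -
  show "0 \<le> x \<bullet> (Qmat P *v x)"
    by (rule block_diagonal_psd[where own = "sown P"]) (use assms in \<open>simp_all add: mpc_setup_def\<close>)
  show "0 < v \<bullet> (Rmat P *v v)" if "v \<noteq> 0"
    by (rule block_diagonal_pd[where own = "uown P"])
      (use assms that in \<open>simp_all add: mpc_setup_def\<close>)
qed

text \<open>
  All other terms of the cost are nonnegative, so a single input term is bounded by the whole.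
  The constant depends neither on the sequence nor on the time step, which confines a whole
  sublevel set to a product of balls of one radius.
\<close>

lemma cost_coercive:
  assumes "mpc_setup P"
  obtains c where "0 < c" "\<And>u k. k < horizon P \<Longrightarrow> c * (norm (u k))\<^sup>2 \<le> cost P x0 u"
proof -
  have Q: "0 \<le> v \<bullet> (Qmat P *v v)" for v
    using stage_cost_definite(1)[OF assms] .
  have R: "v \<noteq> 0 \<Longrightarrow> 0 < v \<bullet> (Rmat P *v v)" for v
    using stage_cost_definite(2)[OF assms] .
  obtain c where c: "0 < c" "\<And>v. c * (norm v)\<^sup>2 \<le> v \<bullet> (Rmat P *v v)"
    using positive_definite_coercive[of "Rmat P"] R by blast
  have R0: "0 \<le> v \<bullet> (Rmat P *v v)" for v
    using R[of v] by (cases "v = 0") auto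
  show thesis
  proof
    show "c * (norm (u k))\<^sup>2 \<le> cost P x0 u" if "k < horizon P" for u k
    proof -
      have "c * (norm (u k))\<^sup>2 \<le> traj P x0 u k \<bullet> (Qmat P *v traj P x0 u k) + u k \<bullet> (Rmat P *v u k)"
        using c(2)[of "u k"] Q[of "traj P x0 u k"] by linarith
      also have "\<dots> \<le> cost P x0 u"
        unfolding cost_def using that
        by (intro member_le_sum[where f = "\<lambda>k. traj P x0 u k \<bullet> (Qmat P *v traj P x0 u k)
              + u k \<bullet> (Rmat P *v u k)"]) (auto intro: add_nonneg_nonneg Q R0)
      finally show ?thesis .
    qed
  qed (fact c)
qed

text \<open>
  The parallelogram identity for both quadratic forms, applied along the trajectory, which
  depends affinely on the inputs.
\<close>

lemma cost_midpoint:
  "cost P x0 (\<lambda>k. (1 / 2) *\<^sub>R (u k + v k)) = (cost P x0 u + cost P x0 v) / 2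
    - (\<Sum>k<horizon P.
        (traj P x0 u k - traj P x0 v k) \<bullet> (Qmat P *v (traj P x0 u k - traj P x0 v k))
        + (u k - v k) \<bullet> (Rmat P *v (u k - v k))) / 4"
proof -
  let ?x = "traj P x0 u" and ?y = "traj P x0 v"
  let ?q = "\<lambda>x w. x \<bullet> (Qmat P *v x) + w \<bullet> (Rmat P *v w)"
  have "?q ((1 / 2) *\<^sub>R (?x k + ?y k)) ((1 / 2) *\<^sub>R (u k + v k))
      = (?q (?x k) (u k) + ?q (?y k) (v k)) / 2 - ?q (?x k - ?y k) (u k - v k) / 4" for k
    unfolding quadratic_form_midpoint by argo
  then have "cost P x0 (\<lambda>k. (1 / 2) *\<^sub>R (u k + v k))
      = (\<Sum>k<horizon P. (?q (?x k) (u k) + ?q (?y k) (v k)) / 2 - ?q (?x k - ?y k) (u k - v k) / 4)"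
    unfolding cost_def traj_midpoint by presburger
  also have "\<dots> = ((\<Sum>k<horizon P. ?q (?x k) (u k)) + (\<Sum>k<horizon P. ?q (?y k) (v k))) / 2
      - (\<Sum>k<horizon P. ?q (?x k - ?y k) (u k - v k)) / 4"
    by (simp only: sum_subtractf sum_divide_distrib[symmetric]
        sum.distrib[of "\<lambda>k. ?q (?x k) (u k)" "\<lambda>k. ?q (?y k) (v k)"])
  finally show ?thesis
    unfolding cost_def .
qed

lemma local_minimizer_exists:
  assumes plant: "mpc_setup P" and ne: "uhat \<in> feasible P x0"
  shows "\<exists>u. is_arg_min (cost P x0) (\<lambda>v. v \<in> local_feasible P x0 uhat i) u"
proof -
  obtain c where c: "0 < c" "\<And>u k. k < horizon P \<Longrightarrow> c * (norm (u k))\<^sup>2 \<le> cost P x0 u"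
    using cost_coercive[OF plant] by blast
  define r where "r = sqrt (cost P x0 uhat / c)"
  define K where "K = local_feasible P x0 uhat i \<inter> {u. cost P x0 u \<le> cost P x0 uhat}"
  \<comment> \<open>Inputs from the horizon on vanish, hence the trivial factors of the product.\<close>
  define D :: "nat \<Rightarrow> (real ^ 'c) set" where
    "D = (\<lambda>k. if k < horizon P then cball 0 r else {0})"
  have "compactin (product_topology (\<lambda>_. euclidean) UNIV) (PiE UNIV D)"
    unfolding compactin_PiE by (auto simp: D_def)
  then have "compact (PiE UNIV D)"
    by (simp add: euclidean_product_topology)
  moreover have "closed K"
    unfolding K_def
    by (intro closed_Int closed_local_feasible plant closed_Collect_le continuous_on_cost
        continuous_intros)
  moreover have "K \<subseteq> PiE UNIV D"
  proof
    fix u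
    assume "u \<in> K"
    then have tail: "\<And>k. horizon P \<le> k \<Longrightarrow> u k = 0" and le: "cost P x0 u \<le> cost P x0 uhat"
      unfolding K_def local_feasible_def feasible_def input_seqs_def by auto
    have "norm (u k) \<le> r" if "k < horizon P" for k
    proof -
      have "c * (norm (u k))\<^sup>2 \<le> cost P x0 uhat"
        using c(2)[OF that, of u] le by linarith
      then show ?thesis
        unfolding r_def using c(1) by (intro real_le_rsqrt) (simp add: field_simps)
    qed
    then show "u \<in> PiE UNIV D"
      using tail by (auto simp: D_def)
  qed
  ultimately have "compact K"
    by (metis compact_Int_closed inf.absorb_iff2)
  moreover have uhat: "uhat \<in> K"
    using ne unfolding K_def local_feasible_def by simp
  ultimately obtain u where u: "u \<in> K" "\<And>v. v \<in> K \<Longrightarrow> cost P x0 u \<le> cost P x0 v"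
    using continuous_attains_inf[of K "cost P x0"] continuous_on_cost by blast
  have "cost P x0 u \<le> cost P x0 v" if "v \<in> local_feasible P x0 uhat i" for v
    using u(2)[of v] u(2)[OF uhat] that unfolding K_def by fastforce
  then show ?thesis
    using u(1) unfolding is_arg_min_def K_def by (auto simp: not_less)
qed

lemma local_minimizer_unique:
  assumes plant: "mpc_setup P"
    and u: "is_arg_min (cost P x0) (\<lambda>v. v \<in> local_feasible P x0 uhat i) u"
    and v: "is_arg_min (cost P x0) (\<lambda>v. v \<in> local_feasible P x0 uhat i) v"
  shows "u = v"
proof -
  define q where "q k =
    (traj P x0 u k - traj P x0 v k) \<bullet> (Qmat P *v (traj P x0 u k - traj P x0 v k))
    + (u k - v k) \<bullet> (Rmat P *v (u k - v k))" for k
  have Q: "0 \<le> w \<bullet> (Qmat P *v w)" for w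
    using stage_cost_definite(1)[OF plant] .
  have R: "w \<noteq> 0 \<Longrightarrow> 0 < w \<bullet> (Rmat P *v w)" for w
    using stage_cost_definite(2)[OF plant] .
  have R0: "0 \<le> w \<bullet> (Rmat P *v w)" for w
    using R[of w] by (cases "w = 0") auto
  have q0: "0 \<le> q k" for k
    unfolding q_def by (intro add_nonneg_nonneg Q R0)
  have mem: "u \<in> local_feasible P x0 uhat i" "v \<in> local_feasible P x0 uhat i"
    using u v unfolding is_arg_min_def by auto
  have min: "cost P x0 u \<le> cost P x0 w" "cost P x0 v \<le> cost P x0 w"
    if "w \<in> local_feasible P x0 uhat i" for w
    using u v that by (simp_all add: is_arg_min_linorder)
  have "cost P x0 u \<le> (cost P x0 u + cost P x0 v) / 2 - (\<Sum>k<horizon P. q k) / 4"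
    using min(1)[OF local_feasible_midpoint[OF plant mem]] unfolding cost_midpoint q_def .
  then have "(\<Sum>k<horizon P. q k) \<le> 0"
    using min(2)[OF mem(1)] by (simp add: field_simps)
  then have "(\<Sum>k<horizon P. q k) = 0"
    by (intro antisym sum_nonneg q0)
  then have zero: "q k = 0" if "k < horizon P" for k
    using that q0 by (simp add: sum_nonneg_eq_0_iff)
  have "u k = v k" for k
  proof (cases "k < horizon P")
    case True
    then have "(u k - v k) \<bullet> (Rmat P *v (u k - v k)) \<le> 0"
      using zero[OF True] Q[of "traj P x0 u k - traj P x0 v k"] unfolding q_def by linarith
    then show ?thesis
      using R[of "u k - v k"] by (cases "u k = v k") (simp_all add: not_less[symmetric])
  next
    case False
    then show ?thesis
      using mem unfolding local_feasible_def feasible_def input_seqs_def by auto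
  qed
  then show ?thesis
    by blast
qed

lemma local_minimizer_feasible:
  assumes "mpc_setup P" "uhat \<in> feasible P x0"
  shows "local_minimizer P x0 uhat i \<in> local_feasible P x0 uhat i"
proof -
  have "\<exists>!u. is_arg_min (cost P x0) (\<lambda>v. v \<in> local_feasible P x0 uhat i) u"
    using local_minimizer_exists[OF assms, of i]
    by (rule ex_ex1I) (rule local_minimizer_unique[OF assms(1)])
  then have "is_arg_min (cost P x0) (\<lambda>v. v \<in> local_feasible P x0 uhat i)
      (local_minimizer P x0 uhat i)"
    unfolding local_minimizer_def by (rule theI')
  then show ?thesis
    by (simp add: is_arg_min_def)
qed

section \<open>Equality of the two updates\<close>

theorem mainTheorem4:
  fixes P :: "('i::finite, 's::finite, 'u::finite) mpc"
    and x0 :: "real ^ 's"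
    and lam :: "'i \<Rightarrow> real"
    and uprev :: "nat \<Rightarrow> real ^ 'u"
    and us :: "'i \<Rightarrow> nat \<Rightarrow> real ^ 'u"
    and unew :: "nat \<Rightarrow> real ^ 'u"
    and uloc :: "'i \<Rightarrow> nat \<Rightarrow> real ^ 'u"
  assumes "mpc_setup P"
    and "\<forall>i. 0 < lam i \<and> lam i < 1"
    and "(\<Sum>i\<in>UNIV. lam i) = 1"
    and "uprev \<in> feasible P x0"
    and "\<forall>j. us j = local_minimizer P x0 uprev j"
    and "\<forall>k. unew k = (\<Sum>j\<in>UNIV. lam j *\<^sub>R us j k)"
    and "\<forall>i k. uloc i k =
           (\<Sum>j\<in>nbhd P i. lam j *\<^sub>R input_part P {i} (us j) k)
           + (1 - (\<Sum>j\<in>nbhd P i. lam j)) *\<^sub>R input_part P {i} uprev k"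
  shows "\<forall>i. input_part P {i} unew = uloc i"
proof (intro allI ext)
  fix i k
  let ?c = "\<lambda>w. subvec (uown P) {i} w"
  have keep: "?c (us j k) = ?c (uprev k)" if "j \<notin> nbhd P i" for j
  proof -
    have "us j \<in> local_feasible P x0 uprev j"
      using assms(5) local_minimizer_feasible[OF assms(1,4)] by simp
    then have "subvec (uown P) (- nbhd P j) (us j k) = subvec (uown P) (- nbhd P j) (uprev k)"
      unfolding local_feasible_def input_part_def by (auto dest: fun_cong)
    then show ?thesis
      by (rule subvec_mono_eq) (use that nbhd_sym[OF assms(1)] in auto)
  qed
  have "?c (unew k) = (\<Sum>j\<in>UNIV. lam j *\<^sub>R ?c (us j k))"
    using assms(6) by (simp add: linear_sum[OF linear_subvec] linear_scale[OF linear_subvec])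
  also have "\<dots> = (\<Sum>j\<in>nbhd P i. lam j *\<^sub>R ?c (us j k)) + (\<Sum>j\<in>- nbhd P i. lam j *\<^sub>R ?c (us j k))"
    by (subst sum.union_disjoint[symmetric]) (auto simp: Compl_partition)
  also have "(\<Sum>j\<in>- nbhd P i. lam j *\<^sub>R ?c (us j k)) = (\<Sum>j\<in>- nbhd P i. lam j) *\<^sub>R ?c (uprev k)"
    by (simp add: keep scaleR_sum_left)
  also have "(\<Sum>j\<in>- nbhd P i. lam j) = 1 - (\<Sum>j\<in>nbhd P i. lam j)"
    using assms(3) by (simp add: Compl_eq_Diff_UNIV sum_diff)
  finally show "input_part P {i} unew k = uloc i k"
    using assms(7) by (simp add: input_part_def)
qed

end
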